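(* Let $(X_k)_k$ be a sequence of i.i.d. symmetric real random variables with the same law as $X$, where $\mathbb{E}(X)=0$, $\mathbb{E}(X^2)=1$ and $\mathbb{E}(X^4)<3$. Set $$Z_n:=\frac1{n^{1/4}}\sum_{k=1}^nX_k,\quad \gamma_n:=n^{1/4},\quad C:=\frac{3-\mathbb{E}(X^4)}6>0,\quad \Phi_C(x):=e^{-Cx^4/4},\quad c_1:=\sqrt{2\pi}\,\mathbb{E}(\Phi_C(G)),\ G\sim\mathcal{N}(0,1).$$ Let $H_n\sim\mathscr{H}(\Phi_C,\gamma_n)$ and $h\in\mathcal{H}^1_\Phi$, and set $\sigma_{1,3}:=\max\big(\mathbb{E}(|X|),\ \mathbb{E}(|X|^3/2)\big)$. Then $$\big|\mathbb{E}(h(Z_n))-\mathbb{E}(h(H_n))\big|\leq\frac{4\sqrt{2(1-C)}}{\gamma_n}\|h'\|_\infty+\frac4{\gamma_n^2}\|h\|_\infty\Big(C\,c_1\,\sigma_{1,3}+\frac1{\gamma_n^2}\Big).$$ In particular, for $n$ large enough, $$d_{\mathcal{H}^1_\Phi}(Z_n,H_n)\leq\frac{4\sqrt{2(1-C)}}{\gamma_n}+O\Big(\frac1{\gamma_n^2}\Big),\qquad d_{\mathcal{H}^1_\Phi}\Big(\frac{Z_n}{\gamma_n},\frac{H_n}{\gamma_n}\Big)\leq\frac{4\sqrt{2(1-C)}}{\gamma_n^2}+O\Big(\frac1{\gamma_n^4}\Big).$$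
   Context: $X$ symmetric means that $X$ and $-X$ have the same law. For $\gamma>0$, $\mathscr{H}(\Phi_C,\gamma)$ is the probability distribution on $\mathbb{R}$ with density proportional to $\Phi_C(x/\gamma^2)e^{-x^2/(2\gamma^2)}=\exp\big(-\frac{x^2}{2\gamma^2}-\frac{C}{\gamma^8}\frac{x^4}4\big)$. Moreover $$\mathcal{H}^1_\Phi:=\Big\{h\in\mathcal{C}^1(\mathbb{R}) : \|h\|_\infty\leq1,\ \|h'\|_\infty\leq1,\ \lim_{\pm\infty}h=0,\ \int_{\mathbb{R}}|h'|<\infty\Big\},$$ $$d_{\mathcal{H}^1_\Phi}(U,V):=\sup_{h\in\mathcal{H}^1_\Phi}\big|\mathbb{E}(h(U))-\mathbb{E}(h(V))\big|$$ for real random variables $U,V$. *)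

theory Defs
  imports "HOL-Probability.Probability" "HOL-Library.Landau_Symbols"
begin

text \<open>The supremum is taken in the reals, so \<open>sup_norm f\<close> is only meaningful for bounded \<open>f\<close>;
  the test functions below are therefore required to be bounded explicitly.\<close>

definition sup_norm :: "(real \<Rightarrow> real) \<Rightarrow> real" where
  "sup_norm f = (SUP x. \<bar>f x\<bar>)"

definition H1_Phi :: "(real \<Rightarrow> real) set" where
  "H1_Phi = {h. h C1_differentiable_on UNIV
      \<and> bounded (range h) \<and> sup_norm h \<le> 1
      \<and> bounded (range (deriv h)) \<and> sup_norm (deriv h) \<le> 1
      \<and> (h \<longlongrightarrow> 0) at_top \<and> (h \<longlongrightarrow> 0) at_bot
      \<and> integrable lborel (\<lambda>x. \<bar>deriv h x\<bar>)}"

text \<open>The two random variables may live on different probability spaces. The set whose supremum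
  is taken contains \<open>0\<close> and is bounded by \<open>2\<close>, so the supremum in the reals is the intended one.\<close>

definition dist_H1_Phi ::
    "'a measure \<Rightarrow> ('a \<Rightarrow> real) \<Rightarrow> 'b measure \<Rightarrow> ('b \<Rightarrow> real) \<Rightarrow> real" where
  "dist_H1_Phi M U N V =
     (SUP h\<in>H1_Phi. \<bar>(\<integral>\<omega>. h (U \<omega>) \<partial>M) - (\<integral>\<omega>. h (V \<omega>) \<partial>N)\<bar>)"

definition Phi :: "real \<Rightarrow> real \<Rightarrow> real" where
  "Phi C x = exp (- C * x ^ 4 / 4)"

definition H_weight :: "(real \<Rightarrow> real) \<Rightarrow> real \<Rightarrow> real \<Rightarrow> real" where
  "H_weight \<Phi> \<gamma> x = \<Phi> (x / \<gamma>\<^sup>2) * exp (- x\<^sup>2 / (2 * \<gamma>\<^sup>2))"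

definition H_law :: "(real \<Rightarrow> real) \<Rightarrow> real \<Rightarrow> real measure" where
  "H_law \<Phi> \<gamma> = density lborel
     (\<lambda>x. ennreal (H_weight \<Phi> \<gamma> x / (\<integral>y. H_weight \<Phi> \<gamma> y \<partial>lborel)))"

end

theory Submission imports Defs "HOL-Real_Asymp.Real_Asymp" begin

text \<open>Both laws are compared with that of \<open>\<gamma>\<^sub>n G\<close>, where \<open>G\<close> is standard normal.
  For \<open>Z\<^sub>n = \<gamma>\<^sub>n W\<^sub>n\<close> with \<open>W\<^sub>n = \<Sum> X\<^sub>k / \<surd>n\<close>, Stein's method gives
  \<open>\<bar>E g(W\<^sub>n) - E g(G)\<bar> \<le> Lip(g) (E\<bar>X\<bar>\<^sup>3 + 2 E\<bar>X\<bar>) / \<surd>n\<close>, to be used with \<open>g(x) = h(\<gamma>\<^sub>n x)\<close>; the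
  moments satisfy \<open>E\<bar>X\<bar>\<^sup>3 + 2 E\<bar>X\<bar> \<le> 4 - 3C \<le> 4 \<surd>(2(1 - C))\<close>.
  The law of \<open>H\<^sub>n / \<gamma>\<^sub>n\<close> is the normal law tilted by \<open>exp(- C x\<^sup>4 / (4n))\<close>, whose mean under the normal law
  is at least \<open>1 - 3C/(4n)\<close>; hence \<open>\<bar>E h(\<gamma>\<^sub>n G) - E h(H\<^sub>n)\<bar> \<le> \<parallel>h\<parallel>\<^sub>\<infinity> / n\<close>. This error is already of order
  \<open>1 / \<gamma>\<^sub>n\<^sup>4\<close>, as the rescaled distance requires.\<close>

section \<open>Stein's equation for the normal law\<close>

lemma set_integrable_lborel_of_integrable:
  fixes g :: "real \<Rightarrow> real"
  assumes "integrable lborel g" "A \<in> sets borel"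
  shows "set_integrable lborel A g"
  unfolding set_integrable_def using assms by (intro integrable_mult_indicator) auto

text \<open>Since the range of integration is unbounded below, the part under \<open>x - 1\<close>
  is split off as a constant, and the fundamental theorem of calculus is applied on the compact
  interval \<open>{a..b}\<close>, which has \<open>x\<close> in its interior.\<close>

lemma DERIV_lower_integral:
  fixes g :: "real \<Rightarrow> real"
  assumes g: "integrable lborel g" and cont: "continuous_on UNIV g"
  shows "((\<lambda>x. LINT t:{..x}|lborel. g t) has_real_derivative g x) (at x)"
proof -
  define a b where "a = x - 1" and "b = x + 1"
  note si = set_integrable_lborel_of_integrable[OF g]
  have eq: "(LINT t:{..y}|lborel. g t) = (LINT t:{..<a}|lborel. g t) + integral {a..y} g"
    if "y \<in> {a<..<b}" for y
  proof -
    have "{..y} = {..<a} \<union> {a..y}" using that by auto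
    moreover have "(LINT t:{..<a} \<union> {a..y}|lborel. g t)
        = (LINT t:{..<a}|lborel. g t) + (LINT t:{a..y}|lborel. g t)"
      by (intro set_integral_Un si) auto
    moreover have "(LINT t:{a..y}|lborel. g t) = integral {a..y} g"
      by (intro set_borel_integral_eq_integral(2) si) auto
    ultimately show ?thesis by simp
  qed
  have "((\<lambda>y. integral {a..y} g) has_real_derivative g x) (at x within {a..b})"
    by (rule integral_has_real_derivative) (auto simp: a_def b_def intro: continuous_on_subset[OF cont])
  moreover have "at x within {a..b} = at x"
    by (rule at_within_interior) (auto simp: a_def b_def)
  ultimately have "((\<lambda>y. (LINT t:{..<a}|lborel. g t) + integral {a..y} g) has_real_derivative g x) (at x)"
    by (auto intro!: derivative_eq_intros)
  then show ?thesis
    by (rule has_field_derivative_transform_within_open[where S = "{a<..<b}"])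
      (auto simp: eq, auto simp: a_def b_def)
qed

lemma tendsto_lower_integral_at_top:
  fixes g :: "real \<Rightarrow> real"
  assumes g: "integrable lborel g"
  shows "((\<lambda>x. LINT t:{..x}|lborel. g t) \<longlongrightarrow> (\<integral>t. g t \<partial>lborel)) at_top"
  unfolding set_lebesgue_integral_def
proof (rule integral_dominated_convergence_at_top[where w = "\<lambda>t. \<bar>g t\<bar>"])
  show "AE t in lborel. ((\<lambda>x. indicat_real {..x} t *\<^sub>R g t) \<longlongrightarrow> g t) at_top"
  proof (rule AE_I2, rule tendsto_eventually)
    fix t :: real
    show "\<forall>\<^sub>F x in at_top. indicat_real {..x} t *\<^sub>R g t = g t"
      using eventually_ge_at_top[of t] by eventually_elim auto
  qed
qed (use g in \<open>auto split: split_indicator intro!: always_eventually\<close>)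

lemma tendsto_lower_integral_at_bot:
  fixes g :: "real \<Rightarrow> real"
  assumes g: "integrable lborel g"
  shows "((\<lambda>x. LINT t:{..x}|lborel. g t) \<longlongrightarrow> 0) at_bot"
proof -
  \<comment> \<open>The limit at minus infinity is reflected into one at plus infinity, where
    dominated convergence along a real parameter applies.\<close>
  have "((\<lambda>x. \<integral>t. indicator {..-x} t *\<^sub>R g t \<partial>lborel) \<longlongrightarrow> (\<integral>t. 0 \<partial>(lborel::real measure))) at_top"
  proof (rule integral_dominated_convergence_at_top[where w = "\<lambda>t. \<bar>g t\<bar>"])
    show "AE t in lborel. ((\<lambda>x. indicat_real {..-x} t *\<^sub>R g t) \<longlongrightarrow> 0) at_top"
    proof (rule AE_I2, rule tendsto_eventually)
      fix t :: real
      show "\<forall>\<^sub>F x in at_top. indicat_real {..-x} t *\<^sub>R g t = 0"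
        using eventually_gt_at_top[of "-t"] by eventually_elim auto
    qed
  qed (use g in \<open>auto split: split_indicator intro!: always_eventually\<close>)
  then show ?thesis
    unfolding set_lebesgue_integral_def filterlim_at_bot_mirror by simp
qed

section \<open>The standard normal density and its Mills ratio\<close>

lemma std_normal_density_eq: "std_normal_density x = exp (- x\<^sup>2 / 2) / sqrt (2 * pi)"
  by (simp add: normal_density_def)

lemma DERIV_std_normal_density [derivative_intros]:
  "(f has_real_derivative f') (at x) \<Longrightarrow>
   ((\<lambda>x. std_normal_density (f x)) has_real_derivative - f x * std_normal_density (f x) * f') (at x)"
  unfolding std_normal_density_eq divide_inverse[of "exp _"]
  by (auto intro!: derivative_eq_intros)

lemma continuous_std_normal_density [continuous_intros]:
  "continuous_on A f \<Longrightarrow> continuous_on A (\<lambda>x. std_normal_density (f x :: real))"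
  unfolding std_normal_density_eq by (auto intro!: continuous_intros)

lemma integrable_std_normal_density_times_id:
  "integrable lborel (\<lambda>x. std_normal_density x * x)"
  using integrable_std_normal_moment[of 1] by simp

lemma integral_std_normal_density_times_id: "(\<integral>x. std_normal_density x * x \<partial>lborel) = 0"
  using integral_std_normal_moment_odd[of 0] by simp

text \<open>Both sides have derivative \<open>std_normal_density x * x\<close> and vanish at minus
  infinity, so their difference is the constant 0.\<close>

lemma lower_integral_id_std_normal:
  "(LINT t:{..x}|lborel. std_normal_density t * t) = - std_normal_density x"
proof -
  let ?D = "\<lambda>x. (LINT t:{..x}|lborel. std_normal_density t * t) + std_normal_density x"
  have "((\<lambda>x. LINT t:{..x}|lborel. std_normal_density t * t)
      has_real_derivative std_normal_density x * x) (at x)" for x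
    by (intro DERIV_lower_integral integrable_std_normal_density_times_id continuous_intros)
  then have "(?D has_real_derivative 0) (at x)" for x
    by (auto intro!: derivative_eq_intros)
  then have const: "?D x = ?D y" for y
    using DERIV_isconst_all by blast
  have "(std_normal_density \<longlongrightarrow> 0) at_bot"
    unfolding std_normal_density_eq by real_asymp
  then have "(?D \<longlongrightarrow> 0 + 0) at_bot"
    by (intro tendsto_add tendsto_lower_integral_at_bot integrable_std_normal_density_times_id)
  moreover have "?D = (\<lambda>_. ?D x)" using const by metis
  ultimately have "((\<lambda>_::real. ?D x) \<longlongrightarrow> 0) at_bot" by simp
  then have "?D x = 0"
    by (rule tendsto_unique[OF trivial_limit_at_bot_linorder tendsto_const])
  then show ?thesis by simp
qed

text \<open>The distribution function plus \<open>m\<close>, called \<open>?D\<close>, has the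
  positive derivative \<open>2 * std_normal_density x / (1 + x\<^sup>2)\<^sup>2\<close>. It
  therefore increases from its limit 0 at minus infinity to its limit 1 at plus infinity, which are
  the two bounds. The first has content for negative \<open>x\<close>, the second for positive
  \<open>x\<close>.\<close>

lemma Mills_ratio_bounds:
  fixes x :: real
  defines "m \<equiv> x * std_normal_density x / (1 + x\<^sup>2)"
  shows "- m \<le> (LINT t:{..x}|lborel. std_normal_density t)" (is ?lower)
    and "(LINT t:{..x}|lborel. std_normal_density t) + m \<le> 1" (is ?upper)
proof -
  let ?D = "\<lambda>x. (LINT t:{..x}|lborel. std_normal_density t) + x * std_normal_density x / (1 + x\<^sup>2)"
  have int: "integrable lborel std_normal_density"
    by (simp add: integrable_normal_density)
  have nz: "1 + x\<^sup>2 \<noteq> 0" for x :: real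
    by (smt (verit) zero_le_power2)
  have dP: "((\<lambda>x. LINT t:{..x}|lborel. std_normal_density t) has_real_derivative std_normal_density x) (at x)" for x
    by (intro DERIV_lower_integral int continuous_intros)
  have deriv: "(?D has_real_derivative 2 * std_normal_density x / (1 + x\<^sup>2)\<^sup>2) (at x)" for x
  proof -
    have "std_normal_density x + ((std_normal_density x - x * x * std_normal_density x) * (1 + x\<^sup>2)
        - x * std_normal_density x * (2 * x)) / (1 + x\<^sup>2)\<^sup>2 = 2 * std_normal_density x / (1 + x\<^sup>2)\<^sup>2"
    proof -
      define q \<phi> where "q = 1 + x\<^sup>2" and "\<phi> = std_normal_density x"
      have "\<phi> * q\<^sup>2 + ((\<phi> - x * x * \<phi>) * q - x * \<phi> * (2 * x)) = 2 * \<phi>"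
        unfolding q_def by (simp add: power2_eq_square algebra_simps)
      then have "\<phi> + ((\<phi> - x * x * \<phi>) * q - x * \<phi> * (2 * x)) / q\<^sup>2 = 2 * \<phi> / q\<^sup>2"
        using nz[of x] by (simp add: q_def[symmetric] add_divide_eq_iff)
      then show ?thesis by (simp only: q_def \<phi>_def)
    qed
    moreover have "((\<lambda>x. x * std_normal_density x / (1 + x\<^sup>2)) has_real_derivative
        ((std_normal_density x - x * x * std_normal_density x) * (1 + x\<^sup>2)
          - x * std_normal_density x * (2 * x)) / (1 + x\<^sup>2)\<^sup>2) (at x)"
    proof -
      have dm: "((\<lambda>x. x * std_normal_density x) has_real_derivative
          std_normal_density x - x * x * std_normal_density x) (at x)"
        by (auto intro!: derivative_eq_intros)
      have dq: "((\<lambda>x. 1 + x\<^sup>2) has_real_derivative 2 * x) (at x)"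
        by (auto intro!: derivative_eq_intros)
      show ?thesis
        using DERIV_divide[OF dm dq nz] by (simp only: power2_eq_square[of "1 + x\<^sup>2"])
    qed
    ultimately show ?thesis
      by (intro DERIV_cong[OF DERIV_add[OF dP[of x]]])
  qed
  have mono: "?D y \<le> ?D z" if "y \<le> z" for y z
  proof (rule DERIV_nonneg_imp_nondecreasing[OF that], intro exI conjI)
    show "(?D has_real_derivative 2 * std_normal_density t / (1 + t\<^sup>2)\<^sup>2) (at t)" for t
      by (rule deriv)
  qed simp
  have "((\<lambda>x. x * std_normal_density x / (1 + x\<^sup>2)) \<longlongrightarrow> 0) at_bot"
    unfolding std_normal_density_eq by real_asymp
  then have "(?D \<longlongrightarrow> 0 + 0) at_bot"
    by (intro tendsto_add tendsto_lower_integral_at_bot int)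
  moreover have "\<forall>\<^sub>F y in at_bot. ?D y \<le> ?D x"
    using eventually_le_at_bot[of x] by eventually_elim (rule mono)
  ultimately have "0 \<le> ?D x"
    by (intro tendsto_upperbound[where F = at_bot and f = ?D]) auto
  then show ?lower by (simp add: m_def)
  have "((\<lambda>x. x * std_normal_density x / (1 + x\<^sup>2)) \<longlongrightarrow> 0) at_top"
    unfolding std_normal_density_eq by real_asymp
  then have "(?D \<longlongrightarrow> (\<integral>t. std_normal_density t \<partial>lborel) + 0) at_top"
    by (intro tendsto_add tendsto_lower_integral_at_top int)
  moreover have "\<forall>\<^sub>F y in at_top. ?D x \<le> ?D y"
    using eventually_ge_at_top[of x] by eventually_elim (rule mono)
  ultimately have "?D x \<le> 1"
    by (intro tendsto_lowerbound[where F = at_top and f = ?D]) (auto simp: integral_normal_density)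
  then show ?upper by (simp add: m_def)
qed

section \<open>Derivative bounds for the solution of Stein's equation\<close>

text \<open>The sign of \<open>k x\<close> decides which tail is used. If
  \<open>k x \<le> 0\<close>, then \<open>k t \<le> k x\<close> on the left tail, and the lower
  Mills bound is multiplied by the nonpositive number \<open>k x\<close>. If
  \<open>0 \<le> k x\<close>, the same comparison on the right tail uses the upper Mills bound, and
  centredness makes the integral over the right tail minus the one over the left.\<close>

lemma centred_mono_lower_integral_le:
  fixes k :: "real \<Rightarrow> real"
  assumes mono: "mono k" and int: "integrable lborel (\<lambda>t. std_normal_density t * k t)"
    and centred: "(\<integral>t. std_normal_density t * k t \<partial>lborel) = 0"
  shows "(1 + x\<^sup>2) * (LINT t:{..x}|lborel. std_normal_density t * k t)
           + x * k x * std_normal_density x \<le> 0"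
proof -
  let ?\<phi> = "std_normal_density"
  let ?F = "LINT t:{..x}|lborel. ?\<phi> t * k t"
  let ?P = "LINT t:{..x}|lborel. ?\<phi> t"
  note si = set_integrable_lborel_of_integrable
  have int1: "integrable lborel ?\<phi>" by (simp add: integrable_normal_density)
  have intk: "integrable lborel (\<lambda>t. ?\<phi> t * k x)" using int1 by simp
  have pos: "1 + x\<^sup>2 > 0" by (smt (verit) zero_le_power2)
  have split: "(LINT t:{..x}|lborel. g t) + (LINT t:{x<..}|lborel. g t) = (\<integral>t. g t \<partial>lborel)"
    if "integrable lborel g" for g :: "real \<Rightarrow> real"
  proof -
    have "(LINT t:{..x} \<union> {x<..}|lborel. g t) = (LINT t:{..x}|lborel. g t) + (LINT t:{x<..}|lborel. g t)"
      by (intro set_integral_Un si that) auto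
    moreover have "{..x} \<union> {x<..} = UNIV" by auto
    ultimately show ?thesis by (simp add: set_lebesgue_integral_def)
  qed
  consider "k x \<le> 0" | "0 \<le> k x" by linarith
  then have "?F \<le> - (x * ?\<phi> x / (1 + x\<^sup>2)) * k x"
  proof cases
    case 1
    have "?F \<le> (LINT t:{..x}|lborel. ?\<phi> t * k x)"
      by (intro set_integral_mono si int intk)
        (auto intro!: mult_left_mono monoD[OF mono])
    also have "\<dots> = ?P * k x" by simp
    also have "\<dots> \<le> - (x * ?\<phi> x / (1 + x\<^sup>2)) * k x"
      using 1 Mills_ratio_bounds(1)[of x] by (intro mult_right_mono_neg) auto
    finally show ?thesis .
  next
    case 2
    have "(LINT t:{x<..}|lborel. ?\<phi> t * k x) \<le> (LINT t:{x<..}|lborel. ?\<phi> t * k t)"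
      by (intro set_integral_mono si int intk)
        (auto intro!: mult_left_mono monoD[OF mono])
    moreover have "(LINT t:{x<..}|lborel. ?\<phi> t * k x) = (1 - ?P) * k x"
      using split[OF int1] by (simp add: integral_normal_density eq_diff_eq)
    moreover have "(x * ?\<phi> x / (1 + x\<^sup>2)) * k x \<le> (1 - ?P) * k x"
      using 2 Mills_ratio_bounds(2)[of x] by (intro mult_right_mono) auto
    ultimately have "(x * ?\<phi> x / (1 + x\<^sup>2)) * k x \<le> (LINT t:{x<..}|lborel. ?\<phi> t * k t)"
      by linarith
    then show ?thesis using split[OF int] centred by simp
  qed
  then have "(1 + x\<^sup>2) * ?F \<le> (1 + x\<^sup>2) * (- (x * ?\<phi> x / (1 + x\<^sup>2)) * k x)"
    using pos by (intro mult_left_mono) auto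
  also have "\<dots> = - (x * k x * ?\<phi> x)" using pos by (simp add: field_simps)
  finally show ?thesis by simp
qed

lemma mono_linear_plus_Lipschitz:
  fixes g :: "real \<Rightarrow> real"
  assumes "\<And>x y. \<bar>g x - g y\<bar> \<le> L * \<bar>x - y\<bar>"
  shows "mono (\<lambda>x. L * x + g x)"
proof (rule monoI)
  fix x y :: real assume "x \<le> y"
  then show "L * x + g x \<le> L * y + g y" using assms[of x y] by (simp add: algebra_simps)
qed

text \<open>Dividing by \<open>\<phi> x\<close> gives \<open>f'' - k'\<close>, where \<open>f\<close> is the solution of Stein's equation
  \<open>f' - x f = k\<close>. This expression is linear in \<open>k\<close> and equals \<open>- 1\<close> for \<open>k x = x\<close>, so the sign
  for the monotone functions \<open>L x \<plusminus> k x\<close> yields the two-sided bound.\<close>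
lemma centred_Lipschitz_lower_integral_bound:
  fixes k :: "real \<Rightarrow> real"
  assumes lip: "\<And>x y. \<bar>k x - k y\<bar> \<le> L * \<bar>x - y\<bar>"
    and int: "integrable lborel (\<lambda>t. std_normal_density t * k t)"
    and centred: "(\<integral>t. std_normal_density t * k t \<partial>lborel) = 0"
  shows "\<bar>(1 + x\<^sup>2) * (LINT t:{..x}|lborel. std_normal_density t * k t)
           + x * k x * std_normal_density x\<bar> \<le> L * std_normal_density x"
proof -
  let ?\<phi> = "std_normal_density"
  note si = set_integrable_lborel_of_integrable
  note idi = integrable_std_normal_density_times_id
  have *: "(1 + x\<^sup>2) * (LINT t:{..x}|lborel. ?\<phi> t * g t) + x * g x * ?\<phi> x \<le> L * ?\<phi> x"
    if lip: "\<And>x y. \<bar>g x - g y\<bar> \<le> L * \<bar>x - y\<bar>"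
      and int: "integrable lborel (\<lambda>t. ?\<phi> t * g t)"
      and centred: "(\<integral>t. ?\<phi> t * g t \<partial>lborel) = 0" for g
  proof -
    have eq: "(\<lambda>t. ?\<phi> t * (L * t + g t)) = (\<lambda>t. L * (?\<phi> t * t) + ?\<phi> t * g t)"
      by (auto simp: algebra_simps)
    have "(1 + x\<^sup>2) * (LINT t:{..x}|lborel. ?\<phi> t * (L * t + g t)) + x * (L * x + g x) * ?\<phi> x \<le> 0"
    proof (rule centred_mono_lower_integral_le[OF mono_linear_plus_Lipschitz[OF lip]])
      show "integrable lborel (\<lambda>t. ?\<phi> t * (L * t + g t))"
        unfolding eq using int idi by auto
      show "(\<integral>t. ?\<phi> t * (L * t + g t) \<partial>lborel) = 0"
        unfolding eq using int idi centred integral_std_normal_density_times_id by simp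
    qed
    \<comment> \<open>The linear part contributes exactly \<open>- L * ?\<phi> x\<close>: its lower
      integral gives \<open>- (1 + x\<^sup>2) * L * ?\<phi> x\<close>, its boundary term gives
      \<open>x\<^sup>2 * L * ?\<phi> x\<close>.\<close>
    also have "(LINT t:{..x}|lborel. ?\<phi> t * (L * t + g t))
        = L * (LINT t:{..x}|lborel. ?\<phi> t * t) + (LINT t:{..x}|lborel. ?\<phi> t * g t)"
      unfolding eq by (subst set_integral_add) (use si[OF int] si[OF idi] in auto)
    also have "(LINT t:{..x}|lborel. ?\<phi> t * t) = - ?\<phi> x" by (rule lower_integral_id_std_normal)
    finally show ?thesis by (simp add: algebra_simps power2_eq_square)
  qed
  have "(1 + x\<^sup>2) * (LINT t:{..x}|lborel. ?\<phi> t * - k t) + x * - k x * ?\<phi> x \<le> L * ?\<phi> x"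
    by (rule *) (use lip int centred in \<open>auto simp: abs_minus_commute\<close>)
  moreover have "(LINT t:{..x}|lborel. ?\<phi> t * - k t) = - (LINT t:{..x}|lborel. ?\<phi> t * k t)"
    by (simp add: set_lebesgue_integral_def)
  ultimately show ?thesis using *[OF lip int centred] by (simp add: abs_le_iff)
qed

text \<open>The solution is \<open>f = F / \<phi>\<close>, where \<open>F\<close> is the lower
  integral of \<open>\<phi> * k\<close>, \<open>\<phi>\<close> is the normal density and
  \<open>k\<close> is \<open>h\<close> minus its normal mean. From
  \<open>\<phi>' = - x \<phi>\<close> follows \<open>f' = x f + k\<close>, and differentiating again
  gives \<open>f'' = f + x f' + h'\<close>. The constant \<open>2 * L\<close> is \<open>L\<close>
  for \<open>f'' - h'\<close> plus \<open>L\<close> for \<open>h'\<close>.\<close>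

lemma Stein_equation_solution:
  fixes h h' :: "real \<Rightarrow> real"
  assumes h: "\<And>x. (h has_real_derivative h' x) (at x)" and L: "\<And>x. \<bar>h' x\<bar> \<le> L"
    and int: "integrable std_normal_distribution h"
  obtains f f' f'' :: "real \<Rightarrow> real"
  where "\<And>x. (f has_real_derivative f' x) (at x)" "\<And>x. (f' has_real_derivative f'' x) (at x)"
    "\<And>x. \<bar>f'' x\<bar> \<le> 2 * L"
    "\<And>x. f' x - x * f x = h x - (\<integral>t. h t \<partial>std_normal_distribution)"
proof -
  let ?\<phi> = "std_normal_density"
  define k where "k x = h x - (\<integral>t. h t \<partial>std_normal_distribution)" for x
  define F where "F x = (LINT t:{..x}|lborel. ?\<phi> t * k t)" for x
  define f where "f x = F x / ?\<phi> x" for x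
  have conth: "continuous_on UNIV h"
    by (rule DERIV_continuous_on[of UNIV h h']) (use h in simp)
  then have [measurable]: "h \<in> borel_measurable borel"
    by (rule borel_measurable_continuous_onI)
  have contk: "continuous_on UNIV k" unfolding k_def by (intro continuous_intros conth)
  have int1: "integrable lborel ?\<phi>" by (simp add: integrable_normal_density)
  have inth: "integrable lborel (\<lambda>t. ?\<phi> t * h t)"
    using int by (subst (asm) integrable_density) auto
  have eqh: "(\<integral>t. h t \<partial>std_normal_distribution) = (\<integral>t. ?\<phi> t * h t \<partial>lborel)"
    by (subst integral_density) auto
  have intk: "integrable lborel (\<lambda>t. ?\<phi> t * k t)"
    unfolding k_def right_diff_distrib using inth int1 by auto
  have centred: "(\<integral>t. ?\<phi> t * k t \<partial>lborel) = 0"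
    unfolding k_def right_diff_distrib using inth int1
    by (simp add: eqh integral_normal_density)
  have lip: "\<bar>k x - k y\<bar> \<le> L * \<bar>x - y\<bar>" for x y
    using field_differentiable_bound[of UNIV h h' L x y] h L by (simp add: k_def)
  have pos: "?\<phi> x > 0" for x by (simp add: normal_density_pos)
  have dF: "(F has_real_derivative ?\<phi> x * k x) (at x)" for x
    unfolding F_def by (intro DERIV_lower_integral intk continuous_intros contk)
  have dk: "(k has_real_derivative h' x) (at x)" for x
    unfolding k_def using h by (auto intro!: derivative_eq_intros)
  have df: "(f has_real_derivative x * f x + k x) (at x)" for x
    unfolding f_def using pos[of x]
    by (auto intro!: derivative_eq_intros dF simp: field_simps power2_eq_square)
  show ?thesis
  proof
    show "(f has_real_derivative x * f x + k x) (at x)" for x by fact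
    show "((\<lambda>x. x * f x + k x) has_real_derivative f x + x * (x * f x + k x) + h' x) (at x)" for x
      by (auto intro!: derivative_eq_intros df dk)
    show "\<bar>f x + x * (x * f x + k x) + h' x\<bar> \<le> 2 * L" for x
    proof -
      \<comment> \<open>This is \<open>f'' - h'\<close> over the common denominator
        \<open>?\<phi> x\<close>; the numerator is the quantity estimated in
        \<open>centred_Lipschitz_lower_integral_bound\<close>.\<close>
      have "f x + x * (x * f x + k x) = ((1 + x\<^sup>2) * F x + x * k x * ?\<phi> x) / ?\<phi> x"
        using pos[of x] by (simp add: f_def field_simps power2_eq_square)
      also have "\<bar>\<dots>\<bar> \<le> L"
        using centred_Lipschitz_lower_integral_bound[OF lip intk centred, of x] pos[of x]
        unfolding F_def[symmetric] by (simp add: abs_divide pos_divide_le_eq)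
      finally show ?thesis using L[of x] by linarith
    qed
    show "x * f x + k x - x * f x = h x - (\<integral>t. h t \<partial>std_normal_distribution)" for x
      by (simp add: k_def)
  qed
qed

section \<open>Normal approximation of sums of independent variables\<close>

text \<open>The Lagrange remainder asks for the existence of \<open>f''\<close> only, not for its
  continuity. The hypothesis has \<open>2 * L\<close> to match the Stein solution, and the factor
  1/2 in Taylor's formula leaves \<open>L\<close>.\<close>

lemma second_order_Taylor_bound:
  fixes f f' f'' :: "real \<Rightarrow> real"
  assumes f: "\<And>x. (f has_real_derivative f' x) (at x)"
    and f': "\<And>x. (f' has_real_derivative f'' x) (at x)"
    and bound: "\<And>x. \<bar>f'' x\<bar> \<le> 2 * L"
  shows "\<bar>f y - f x - (y - x) * f' x\<bar> \<le> L * (y - x)\<^sup>2"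
proof (cases "x = y")
  case False
  define d where "d m = (if m = 0 then f else if m = 1 then f' else f'')" for m :: nat
  have "\<forall>m t. m < 2 \<and> min x y \<le> t \<and> t \<le> max x y \<longrightarrow> DERIV (d m) t :> d (Suc m) t"
    using f f' by (auto simp: d_def less_2_cases_iff)
  then obtain t where "f y = (\<Sum>m<2. d m x / fact m * (y - x) ^ m) + d 2 t / fact 2 * (y - x)\<^sup>2"
    using Taylor[of 2 d f "min x y" "max x y" x y] False by (auto simp: d_def)
  then have "f y - f x - (y - x) * f' x = f'' t / 2 * (y - x)\<^sup>2"
    by (simp add: d_def numeral_2_eq_2)
  also have "\<bar>\<dots>\<bar> = \<bar>f'' t\<bar> / 2 * (y - x)\<^sup>2" by (simp add: abs_mult)
  also have "\<dots> \<le> L * (y - x)\<^sup>2" using bound[of t] by (intro mult_right_mono) auto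
  finally show ?thesis .
qed simp

text \<open>What is carried over from Stein's equation is a bound on \<open>f''\<close>. It lets
  \<open>f\<close> and \<open>f'\<close> grow at most quadratically, which square integrability of
  \<open>Y\<close> absorbs.\<close>

lemma (in prob_space) integrable_of_quadratic_growth:
  fixes Y :: "'a \<Rightarrow> real" and g :: "real \<Rightarrow> real"
  assumes [measurable]: "Y \<in> borel_measurable M" "g \<in> borel_measurable borel"
    and Y: "integrable M (\<lambda>\<omega>. (Y \<omega>)\<^sup>2)"
    and g: "\<And>y. \<bar>g y\<bar> \<le> a + b * y\<^sup>2"
  shows "integrable M (\<lambda>\<omega>. g (Y \<omega>))"
proof (rule Bochner_Integration.integrable_bound)
  show "integrable M (\<lambda>\<omega>. a + b * (Y \<omega>)\<^sup>2)" using Y by auto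
  show "AE \<omega> in M. norm (g (Y \<omega>)) \<le> norm (a + b * (Y \<omega>)\<^sup>2)"
    using order_trans[OF g abs_ge_self] by auto
qed measurable

text \<open>By Cauchy-Schwarz the squared sum is at most \<open>card I\<close> times the sum of the
  squares.\<close>

lemma (in prob_space) square_integrable_sum:
  fixes Y :: "'i \<Rightarrow> 'a \<Rightarrow> real"
  assumes [measurable]: "\<And>i. i \<in> I \<Longrightarrow> Y i \<in> borel_measurable M"
    and "\<And>i. i \<in> I \<Longrightarrow> integrable M (\<lambda>\<omega>. (Y i \<omega>)\<^sup>2)"
  shows "integrable M (\<lambda>\<omega>. (\<Sum>i\<in>I. Y i \<omega>)\<^sup>2)"
proof (rule Bochner_Integration.integrable_bound)
  show "integrable M (\<lambda>\<omega>. (\<Sum>i\<in>I. (Y i \<omega>)\<^sup>2) * card I)" using assms by auto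
  show "AE \<omega> in M. norm ((\<Sum>i\<in>I. Y i \<omega>)\<^sup>2) \<le> norm ((\<Sum>i\<in>I. (Y i \<omega>)\<^sup>2) * card I)"
    using sum_squared_le_sum_of_squares by (auto simp: sum_nonneg)
qed measurable

lemma power_le_one_plus_power:
  fixes x :: real
  assumes "0 \<le> x" "m \<le> n"
  shows "x ^ m \<le> 1 + x ^ n"
proof (cases "x \<le> 1")
  case True
  then show ?thesis using assms by (smt (verit) power_le_one zero_le_power)
next
  case False
  then have "x ^ m \<le> x ^ n" using \<open>m \<le> n\<close> by (intro power_increasing) auto
  then show ?thesis by simp
qed

lemma (in prob_space) integrable_abs_power_mono:
  fixes Y :: "'a \<Rightarrow> real"
  assumes [measurable]: "Y \<in> borel_measurable M"
    and "integrable M (\<lambda>\<omega>. \<bar>Y \<omega>\<bar> ^ n)" "m \<le> n"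
  shows "integrable M (\<lambda>\<omega>. \<bar>Y \<omega>\<bar> ^ m)"
proof (rule Bochner_Integration.integrable_bound)
  show "integrable M (\<lambda>\<omega>. 1 + \<bar>Y \<omega>\<bar> ^ n)" using assms by auto
  show "AE \<omega> in M. norm (\<bar>Y \<omega>\<bar> ^ m) \<le> norm (1 + \<bar>Y \<omega>\<bar> ^ n)"
    using power_le_one_plus_power[OF _ \<open>m \<le> n\<close>] by (auto simp: abs_of_nonneg)
qed measurable

text \<open>Leave-one-out argument. For each \<open>i\<close>, \<open>f (W \<omega>)\<close> is
  expanded around the sum \<open>V\<close> of the other variables, which is independent of
  \<open>\<xi> i\<close>. In the expectation of \<open>\<xi> i * f W\<close> the zeroth order term
  vanishes because \<open>\<xi> i\<close> is centred, the first order term is the variance times the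
  mean of \<open>f' V\<close>, and the remainder is cubic in \<open>\<xi> i\<close>. Replacing
  \<open>V\<close> by \<open>W\<close> in \<open>f'\<close> gives the second error term.\<close>

lemma (in prob_space) Stein_operator_sum_bound:
  fixes \<xi> :: "'i \<Rightarrow> 'a \<Rightarrow> real" and f f' f'' :: "real \<Rightarrow> real"
  assumes fin: "finite I" and indep: "indep_vars (\<lambda>_. borel) \<xi> I"
    and int3: "\<And>i. i \<in> I \<Longrightarrow> integrable M (\<lambda>\<omega>. \<bar>\<xi> i \<omega>\<bar> ^ 3)"
    and mean: "\<And>i. i \<in> I \<Longrightarrow> (\<integral>\<omega>. \<xi> i \<omega> \<partial>M) = 0"
    and var: "(\<Sum>i\<in>I. \<integral>\<omega>. (\<xi> i \<omega>)\<^sup>2 \<partial>M) = 1"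
    and f: "\<And>x. (f has_real_derivative f' x) (at x)"
    and f': "\<And>x. (f' has_real_derivative f'' x) (at x)"
    and f'': "\<And>x. \<bar>f'' x\<bar> \<le> 2 * L"
  defines "W \<equiv> \<lambda>\<omega>. \<Sum>i\<in>I. \<xi> i \<omega>"
  shows "\<bar>\<integral>\<omega>. f' (W \<omega>) - W \<omega> * f (W \<omega>) \<partial>M\<bar>
    \<le> L * (\<Sum>i\<in>I. (\<integral>\<omega>. \<bar>\<xi> i \<omega>\<bar> ^ 3 \<partial>M) + 2 * (\<integral>\<omega>. (\<xi> i \<omega>)\<^sup>2 \<partial>M) * (\<integral>\<omega>. \<bar>\<xi> i \<omega>\<bar> \<partial>M))"
proof -
  have L: "0 \<le> L" using f''[of 0] by linarith
  have [measurable]: "f \<in> borel_measurable borel" "f' \<in> borel_measurable borel"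
    by (rule borel_measurable_continuous_onI, rule DERIV_continuous_on, rule f,
        rule borel_measurable_continuous_onI, rule DERIV_continuous_on, rule f')
  have meas[measurable]: "\<xi> i \<in> borel_measurable M" if "i \<in> I" for i
    using indep that by (auto simp: indep_vars_def)
  have lip: "\<bar>f' x - f' y\<bar> \<le> 2 * L * \<bar>x - y\<bar>" for x y
    using field_differentiable_bound[of UNIV f' f'' "2 * L" x y] f' f'' by simp
  \<comment> \<open>Both growth bounds come from expanding at 0; linear terms are absorbed by
    \<open>\<bar>y\<bar> \<le> 1 + y\<^sup>2\<close>.\<close>
  have f'_growth: "\<bar>f' y\<bar> \<le> (\<bar>f' 0\<bar> + 2 * L) + 2 * L * y\<^sup>2" for y
  proof -
    have "\<bar>f' y\<bar> \<le> \<bar>f' 0\<bar> + 2 * L * \<bar>y\<bar>" using lip[of y 0] by simp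
    also have "2 * L * \<bar>y\<bar> \<le> 2 * L * (1 + y\<^sup>2)"
      using L power_le_one_plus_power[of "\<bar>y\<bar>" 1 2] by (intro mult_left_mono) auto
    finally show ?thesis by (simp add: algebra_simps)
  qed
  have f_growth: "\<bar>f y\<bar> \<le> (\<bar>f 0\<bar> + \<bar>f' 0\<bar>) + (\<bar>f' 0\<bar> + L) * y\<^sup>2" for y
  proof -
    have "\<bar>f y\<bar> \<le> \<bar>f 0\<bar> + \<bar>y * f' 0\<bar> + L * y\<^sup>2"
      using second_order_Taylor_bound[OF f f' f'', of y 0] by simp
    also have "\<bar>y * f' 0\<bar> \<le> (1 + y\<^sup>2) * \<bar>f' 0\<bar>"
      using power_le_one_plus_power[of "\<bar>y\<bar>" 1 2] by (auto simp: abs_mult intro!: mult_right_mono)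
    finally show ?thesis by (simp add: algebra_simps)
  qed
  have int2: "integrable M (\<lambda>\<omega>. (\<xi> i \<omega>)\<^sup>2)" if "i \<in> I" for i
    using integrable_abs_power_mono[OF meas int3, of i 2] that by simp
  have int1: "integrable M (\<lambda>\<omega>. \<bar>\<xi> i \<omega>\<bar>)" if "i \<in> I" for i
    using integrable_abs_power_mono[OF meas int3, of i 1] that by simp
  have intW2: "integrable M (\<lambda>\<omega>. (\<Sum>i\<in>J. \<xi> i \<omega>)\<^sup>2)" if "J \<subseteq> I" for J
    using that by (intro square_integrable_sum int2 meas) auto
  have intf'W: "integrable M (\<lambda>\<omega>. f' (W \<omega>))"
    unfolding W_def by (intro integrable_of_quadratic_growth[OF _ _ intW2 f'_growth]) auto
  \<comment> \<open>Integrability is proved along with the estimate because the sum over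
    \<open>i\<close> is later taken out of the integral.\<close>
  have step: "integrable M (\<lambda>\<omega>. \<xi> i \<omega> * f (W \<omega>)) \<and>
      \<bar>(\<integral>\<omega>. (\<xi> i \<omega>)\<^sup>2 \<partial>M) * (\<integral>\<omega>. f' (W \<omega>) \<partial>M) - (\<integral>\<omega>. \<xi> i \<omega> * f (W \<omega>) \<partial>M)\<bar>
      \<le> L * ((\<integral>\<omega>. \<bar>\<xi> i \<omega>\<bar> ^ 3 \<partial>M) + 2 * (\<integral>\<omega>. (\<xi> i \<omega>)\<^sup>2 \<partial>M) * (\<integral>\<omega>. \<bar>\<xi> i \<omega>\<bar> \<partial>M))"
    if i: "i \<in> I" for i
  proof -
    note [measurable] = meas[OF i]
    define V where "V \<omega> = (\<Sum>j\<in>I - {i}. \<xi> j \<omega>)" for \<omega>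
    have [measurable]: "V \<in> borel_measurable M" unfolding V_def by measurable
    have W: "W \<omega> = \<xi> i \<omega> + V \<omega>" for \<omega>
      unfolding W_def V_def using fin i by (simp add: sum.remove)
    have [measurable]: "W \<in> borel_measurable M" unfolding W by measurable
    have iv: "indep_var borel (\<xi> i) borel V"
      unfolding V_def using fin i indep by (intro indep_vars_sum) (auto simp: insert_absorb)
    have intV2: "integrable M (\<lambda>\<omega>. (V \<omega>)\<^sup>2)" unfolding V_def by (rule intW2) auto
    have intfV: "integrable M (\<lambda>\<omega>. f (V \<omega>))"
      by (rule integrable_of_quadratic_growth[OF _ _ intV2 f_growth]) auto
    have intf'V: "integrable M (\<lambda>\<omega>. f' (V \<omega>))"
      by (rule integrable_of_quadratic_growth[OF _ _ intV2 f'_growth]) auto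
    have int_xi: "integrable M (\<xi> i)" using int1[OF i] by (simp add: integrable_abs_iff)
    have iv1: "indep_var borel (\<xi> i) borel (\<lambda>\<omega>. f (V \<omega>))"
      using indep_var_compose[OF iv, of "\<lambda>x. x" borel f borel] by (simp add: o_def)
    have iv2: "indep_var borel (\<lambda>\<omega>. (\<xi> i \<omega>)\<^sup>2) borel (\<lambda>\<omega>. f' (V \<omega>))"
      using indep_var_compose[OF iv, of "\<lambda>x. x\<^sup>2" borel f' borel] by (simp add: o_def)
    \<comment> \<open>\<open>R\<close> is \<open>\<xi> i\<close> times the first-order Taylor
      remainder of \<open>f\<close> at \<open>V\<close> with increment \<open>\<xi> i\<close>, hence
      of third order.\<close>
    define R where "R \<omega> = \<xi> i \<omega> * (f (W \<omega>) - f (V \<omega>) - \<xi> i \<omega> * f' (V \<omega>))" for \<omega>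
    have R_le: "\<bar>R \<omega>\<bar> \<le> L * \<bar>\<xi> i \<omega>\<bar> ^ 3" for \<omega>
    proof -
      have "\<bar>R \<omega>\<bar> \<le> \<bar>\<xi> i \<omega>\<bar> * (L * (\<xi> i \<omega>)\<^sup>2)"
        unfolding R_def abs_mult
        using second_order_Taylor_bound[OF f f' f'', of "W \<omega>" "V \<omega>"]
        by (intro mult_left_mono) (auto simp: W)
      then show ?thesis by (simp add: power3_eq_cube power2_eq_square abs_mult[symmetric] mult_ac)
    qed
    have intR: "integrable M R"
    proof (rule Bochner_Integration.integrable_bound)
      show "integrable M (\<lambda>\<omega>. L * \<bar>\<xi> i \<omega>\<bar> ^ 3)" using int3[OF i] by auto
      show "AE \<omega> in M. norm (R \<omega>) \<le> norm (L * \<bar>\<xi> i \<omega>\<bar> ^ 3)"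
        using order_trans[OF R_le abs_ge_self] by auto
      show "R \<in> borel_measurable M" unfolding R_def by measurable
    qed
    have decomp: "(\<lambda>\<omega>. \<xi> i \<omega> * f (W \<omega>)) = (\<lambda>\<omega>. \<xi> i \<omega> * f (V \<omega>) + (\<xi> i \<omega>)\<^sup>2 * f' (V \<omega>) + R \<omega>)"
      by (auto simp: R_def algebra_simps power2_eq_square)
    note ints = indep_var_integrable[OF iv1 int_xi intfV] indep_var_integrable[OF iv2 int2[OF i] intf'V] intR
    have int: "integrable M (\<lambda>\<omega>. \<xi> i \<omega> * f (W \<omega>))"
      unfolding decomp by (intro Bochner_Integration.integrable_add ints)
    have eq: "(\<integral>\<omega>. \<xi> i \<omega> * f (W \<omega>) \<partial>M)
        = (\<integral>\<omega>. (\<xi> i \<omega>)\<^sup>2 \<partial>M) * (\<integral>\<omega>. f' (V \<omega>) \<partial>M) + (\<integral>\<omega>. R \<omega> \<partial>M)"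
      unfolding decomp using ints
      by (simp add: indep_var_lebesgue_integral[OF iv1 int_xi intfV] mean[OF i]
          indep_var_lebesgue_integral[OF iv2 int2[OF i] intf'V])
    have "\<bar>\<integral>\<omega>. R \<omega> \<partial>M\<bar> \<le> (\<integral>\<omega>. L * \<bar>\<xi> i \<omega>\<bar> ^ 3 \<partial>M)"
      using int3[OF i] R_le intR
      by (intro order_trans[OF integral_abs_bound] integral_mono) auto
    \<comment> \<open>The arguments \<open>W\<close> and \<open>V\<close> differ by
      \<open>\<xi> i\<close>, and \<open>f'\<close> is Lipschitz with constant
      \<open>2 * L\<close>.\<close>
    moreover have "\<bar>(\<integral>\<omega>. f' (W \<omega>) \<partial>M) - (\<integral>\<omega>. f' (V \<omega>) \<partial>M)\<bar> \<le> (\<integral>\<omega>. 2 * L * \<bar>\<xi> i \<omega>\<bar> \<partial>M)"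
    proof -
      have "\<bar>\<integral>\<omega>. f' (W \<omega>) - f' (V \<omega>) \<partial>M\<bar> \<le> (\<integral>\<omega>. 2 * L * \<bar>\<xi> i \<omega>\<bar> \<partial>M)"
      proof (rule order_trans[OF integral_abs_bound], rule integral_mono)
        show "\<bar>f' (W \<omega>) - f' (V \<omega>)\<bar> \<le> 2 * L * \<bar>\<xi> i \<omega>\<bar>" for \<omega>
          using lip[of "W \<omega>" "V \<omega>"] by (simp add: W)
      qed (use intf'W intf'V int1[OF i] in auto)
      then show ?thesis using intf'W intf'V by simp
    qed
    then have "(\<integral>\<omega>. (\<xi> i \<omega>)\<^sup>2 \<partial>M) * \<bar>(\<integral>\<omega>. f' (W \<omega>) \<partial>M) - (\<integral>\<omega>. f' (V \<omega>) \<partial>M)\<bar>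
        \<le> (\<integral>\<omega>. (\<xi> i \<omega>)\<^sup>2 \<partial>M) * (2 * L * (\<integral>\<omega>. \<bar>\<xi> i \<omega>\<bar> \<partial>M))"
      by (intro mult_left_mono) auto
    then have "\<bar>(\<integral>\<omega>. (\<xi> i \<omega>)\<^sup>2 \<partial>M) * ((\<integral>\<omega>. f' (W \<omega>) \<partial>M) - (\<integral>\<omega>. f' (V \<omega>) \<partial>M))\<bar>
        \<le> (\<integral>\<omega>. (\<xi> i \<omega>)\<^sup>2 \<partial>M) * (2 * L * (\<integral>\<omega>. \<bar>\<xi> i \<omega>\<bar> \<partial>M))"
      by (simp add: abs_mult)
    ultimately show ?thesis
      using int by (simp add: eq algebra_simps)
  qed
  have "(\<integral>\<omega>. f' (W \<omega>) - W \<omega> * f (W \<omega>) \<partial>M)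
      = (\<integral>\<omega>. f' (W \<omega>) \<partial>M) - (\<Sum>i\<in>I. \<integral>\<omega>. \<xi> i \<omega> * f (W \<omega>) \<partial>M)"
  proof -
    have "(\<lambda>\<omega>. W \<omega> * f (W \<omega>)) = (\<lambda>\<omega>. \<Sum>i\<in>I. \<xi> i \<omega> * f (W \<omega>))"
      by (simp add: W_def sum_distrib_right)
    then show ?thesis using step intf'W by simp
  qed
  \<comment> \<open>As the variances add up to 1, the mean of \<open>f' W\<close> is split among the
    summands in proportion to them.\<close>
  also have "\<dots> = (\<Sum>i\<in>I. (\<integral>\<omega>. (\<xi> i \<omega>)\<^sup>2 \<partial>M) * (\<integral>\<omega>. f' (W \<omega>) \<partial>M) - (\<integral>\<omega>. \<xi> i \<omega> * f (W \<omega>) \<partial>M))"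
    using var by (simp add: sum_subtractf sum_distrib_right[symmetric])
  also have "\<bar>\<dots>\<bar> \<le> (\<Sum>i\<in>I. L * ((\<integral>\<omega>. \<bar>\<xi> i \<omega>\<bar> ^ 3 \<partial>M)
      + 2 * (\<integral>\<omega>. (\<xi> i \<omega>)\<^sup>2 \<partial>M) * (\<integral>\<omega>. \<bar>\<xi> i \<omega>\<bar> \<partial>M)))"
    using step by (intro order_trans[OF sum_abs] sum_mono) auto
  finally show ?thesis by (simp add: sum_distrib_left)
qed

section \<open>Tilted normal laws\<close>

text \<open>After multiplication by \<open>p\<close>, the mean of \<open>w\<close>, the difference
  is the expectation of \<open>g * (p - w)\<close>. Since \<open>w\<close> and \<open>p\<close> lie
  between 0 and 1, \<open>\<bar>p - w\<bar>\<close> is at most \<open>(1 - w) + (1 - p)\<close>,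
  whose mean is \<open>2 * (1 - p)\<close>.\<close>

lemma (in prob_space) tilted_expectation_bound:
  fixes g w :: "'a \<Rightarrow> real"
  assumes [measurable]: "g \<in> borel_measurable M" "w \<in> borel_measurable M"
    and g: "\<And>\<omega>. \<bar>g \<omega>\<bar> \<le> B" and w: "\<And>\<omega>. 0 \<le> w \<omega>" "\<And>\<omega>. w \<omega> \<le> 1"
    and p: "0 < expectation w"
  shows "\<bar>expectation g - expectation (\<lambda>\<omega>. g \<omega> * w \<omega>) / expectation w\<bar>
    \<le> 2 * B * (1 - expectation w) / expectation w"
proof -
  define p where "p = expectation w"
  have intw: "integrable M w" using w by (intro integrable_const_bound[of _ 1]) auto
  have intg: "integrable M g" using g by (intro integrable_const_bound[of _ B]) auto
  have "\<bar>g \<omega> * w \<omega>\<bar> \<le> B * 1" for \<omega>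
    unfolding abs_mult using g[of \<omega>] w[of \<omega>] by (intro mult_mono) auto
  then have intgw: "integrable M (\<lambda>\<omega>. g \<omega> * w \<omega>)"
    by (intro integrable_const_bound[of _ B]) auto
  have p1: "p \<le> 1" unfolding p_def using intw w by (intro integral_le_const) auto
  have pos: "p > 0" using p by (simp add: p_def)
  have "p * expectation g - expectation (\<lambda>\<omega>. g \<omega> * w \<omega>) = expectation (\<lambda>\<omega>. g \<omega> * (p - w \<omega>))"
    using intg intgw by (simp add: right_diff_distrib mult.commute)
  also have "\<bar>\<dots>\<bar> \<le> expectation (\<lambda>\<omega>. B * ((1 - w \<omega>) + (1 - p)))"
  proof (rule order_trans[OF integral_abs_bound], rule integral_mono)
    show "\<bar>g \<omega> * (p - w \<omega>)\<bar> \<le> B * ((1 - w \<omega>) + (1 - p))" for \<omega>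
      unfolding abs_mult using g[of \<omega>] w[of \<omega>] p1 by (intro mult_mono) auto
    show "integrable M (\<lambda>\<omega>. \<bar>g \<omega> * (p - w \<omega>)\<bar>)"
      using intg intgw by (simp add: right_diff_distrib)
  qed (use intw in auto)
  also have "\<dots> = 2 * B * (1 - p)"
    using intw by (simp add: prob_space p_def algebra_simps)
  finally have "\<bar>p * expectation g - expectation (\<lambda>\<omega>. g \<omega> * w \<omega>)\<bar> / p \<le> 2 * B * (1 - p) / p"
    using pos by (intro divide_right_mono) auto
  moreover have "\<bar>p * expectation g - expectation (\<lambda>\<omega>. g \<omega> * w \<omega>)\<bar> / p
      = \<bar>expectation g - expectation (\<lambda>\<omega>. g \<omega> * w \<omega>) / p\<bar>"
    using pos by (simp add: field_simps abs_if)
  ultimately show ?thesis by (simp add: p_def)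
qed

text \<open>Stein's equation evaluated at the sum and integrated turns the difference of the two
  means into the expectation estimated in \<open>Stein_operator_sum_bound\<close>. The bound
  \<open>B\<close> supplies integrability of \<open>h\<close> under both laws.\<close>

lemma (in prob_space) normal_approximation_sum:
  fixes \<xi> :: "'i \<Rightarrow> 'a \<Rightarrow> real" and h h' :: "real \<Rightarrow> real"
  assumes fin: "finite I" and indep: "indep_vars (\<lambda>_. borel) \<xi> I"
    and int3: "\<And>i. i \<in> I \<Longrightarrow> integrable M (\<lambda>\<omega>. \<bar>\<xi> i \<omega>\<bar> ^ 3)"
    and mean: "\<And>i. i \<in> I \<Longrightarrow> (\<integral>\<omega>. \<xi> i \<omega> \<partial>M) = 0"
    and var: "(\<Sum>i\<in>I. \<integral>\<omega>. (\<xi> i \<omega>)\<^sup>2 \<partial>M) = 1"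
    and h: "\<And>x. (h has_real_derivative h' x) (at x)"
    and L: "\<And>x. \<bar>h' x\<bar> \<le> L" and B: "\<And>x. \<bar>h x\<bar> \<le> B"
  shows "\<bar>(\<integral>\<omega>. h (\<Sum>i\<in>I. \<xi> i \<omega>) \<partial>M) - (\<integral>x. h x \<partial>std_normal_distribution)\<bar>
    \<le> L * (\<Sum>i\<in>I. (\<integral>\<omega>. \<bar>\<xi> i \<omega>\<bar> ^ 3 \<partial>M) + 2 * (\<integral>\<omega>. (\<xi> i \<omega>)\<^sup>2 \<partial>M) * (\<integral>\<omega>. \<bar>\<xi> i \<omega>\<bar> \<partial>M))"
proof -
  interpret N: prob_space std_normal_distribution by (rule prob_space_normal_density) simp
  have [measurable]: "h \<in> borel_measurable borel"
    by (rule borel_measurable_continuous_onI, rule DERIV_continuous_on, rule h)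
  have [measurable]: "\<xi> i \<in> borel_measurable M" if "i \<in> I" for i
    using indep that by (auto simp: indep_vars_def)
  have "integrable std_normal_distribution h"
    using B by (intro N.integrable_const_bound[of _ B]) auto
  from Stein_equation_solution[OF h L this] obtain f f' f'' where
    f: "\<And>x. (f has_real_derivative f' x) (at x)" "\<And>x. (f' has_real_derivative f'' x) (at x)"
    "\<And>x. \<bar>f'' x\<bar> \<le> 2 * L"
    and eq: "\<And>x. f' x - x * f x = h x - (\<integral>t. h t \<partial>std_normal_distribution)"
    by metis
  have "integrable M (\<lambda>\<omega>. h (\<Sum>i\<in>I. \<xi> i \<omega>))"
    using B by (intro integrable_const_bound[of _ B]) auto
  then have "(\<integral>\<omega>. f' (\<Sum>i\<in>I. \<xi> i \<omega>) - (\<Sum>i\<in>I. \<xi> i \<omega>) * f (\<Sum>i\<in>I. \<xi> i \<omega>) \<partial>M)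
      = (\<integral>\<omega>. h (\<Sum>i\<in>I. \<xi> i \<omega>) \<partial>M) - (\<integral>x. h x \<partial>std_normal_distribution)"
    by (simp add: eq prob_space)
  then show ?thesis
    using Stein_operator_sum_bound[OF fin indep int3 mean var f] by simp
qed

section \<open>The law of \<open>H\<close> as a rescaled and tilted normal law\<close>

lemma Phi_measurable [measurable]: "Phi C \<in> borel_measurable borel"
  unfolding Phi_def by measurable

lemma Phi_bounds:
  assumes "0 \<le> C"
  shows "0 \<le> Phi C x" "Phi C x \<le> 1" "1 - C * x ^ 4 / 4 \<le> Phi C x"
  using assms exp_ge_add_one_self[of "- C * x ^ 4 / 4"] by (auto simp: Phi_def)

text \<open>The substitution \<open>x = \<gamma> * y\<close> turns the weight into
  \<open>sqrt (2 * pi)\<close> times the normal density times \<open>Phi C (y / \<gamma>)\<close>.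
  The factor \<open>\<gamma> * sqrt (2 * pi)\<close> appears in the integral and in the
  normalisation, and cancels.\<close>

lemma integral_H_law:
  fixes h :: "real \<Rightarrow> real"
  assumes \<gamma>: "0 < \<gamma>" and C: "0 \<le> C" and [measurable]: "h \<in> borel_measurable borel"
  shows "(\<integral>x. h x \<partial>H_law (Phi C) \<gamma>)
    = (\<integral>y. h (\<gamma> * y) * Phi C (y / \<gamma>) \<partial>std_normal_distribution)
        / (\<integral>y. Phi C (y / \<gamma>) \<partial>std_normal_distribution)"
proof -
  let ?K = "\<integral>y. H_weight (Phi C) \<gamma> y \<partial>lborel"
  have nonneg: "0 \<le> H_weight (Phi C) \<gamma> x" for x
    by (simp add: H_weight_def Phi_def)
  have [measurable]: "H_weight (Phi C) \<gamma> \<in> borel_measurable borel"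
    unfolding H_weight_def by measurable
  have rescale: "(\<integral>x. H_weight (Phi C) \<gamma> x * g x \<partial>lborel)
      = \<gamma> * sqrt (2 * pi) * (\<integral>y. g (\<gamma> * y) * Phi C (y / \<gamma>) \<partial>std_normal_distribution)"
    if [measurable]: "g \<in> borel_measurable borel" for g :: "real \<Rightarrow> real"
  proof -
    have "H_weight (Phi C) \<gamma> (\<gamma> * y) = sqrt (2 * pi) * std_normal_density y * Phi C (y / \<gamma>)" for y
      using \<gamma> by (simp add: H_weight_def std_normal_density_eq power2_eq_square)
    then have "(\<integral>x. H_weight (Phi C) \<gamma> x * g x \<partial>lborel)
        = \<gamma> * (\<integral>y. sqrt (2 * pi) * (std_normal_density y * (g (\<gamma> * y) * Phi C (y / \<gamma>))) \<partial>lborel)"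
      using \<gamma> by (subst lborel_integral_real_affine[where c = \<gamma> and t = 0]) (auto simp: mult_ac)
    then show ?thesis by (subst integral_real_density) auto
  qed
  have "0 \<le> ?K" using nonneg by (intro Bochner_Integration.integral_nonneg) auto
  then have "(\<integral>x. h x \<partial>H_law (Phi C) \<gamma>) = (\<integral>x. H_weight (Phi C) \<gamma> x / ?K * h x \<partial>lborel)"
    unfolding H_law_def using nonneg by (subst integral_real_density) auto
  also have "\<dots> = (\<integral>x. H_weight (Phi C) \<gamma> x * h x \<partial>lborel) / ?K"
    by simp
  also have "?K = \<gamma> * sqrt (2 * pi) * (\<integral>y. Phi C (y / \<gamma>) \<partial>std_normal_distribution)"
    using rescale[of "\<lambda>_. 1"] by simp
  finally show ?thesis using \<gamma> by (simp add: rescale)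
qed

text \<open>By \<open>exp t \<ge> 1 + t\<close> and the normal fourth moment 3, the mean
  \<open>p\<close> of the tilt is at least \<open>1 - 3 * C / (4 * \<gamma> ^ 4)\<close>. With
  \<open>C \<le> 1 / 3\<close> the defect \<open>1 - p\<close> is at most
  \<open>1 / (4 * \<gamma> ^ 4)\<close>, and \<open>tilted_expectation_bound\<close>
  applies.\<close>

lemma normal_vs_H_law:
  fixes h :: "real \<Rightarrow> real"
  assumes \<gamma>: "1 \<le> \<gamma>" and C: "0 \<le> C" "C \<le> 1 / 3"
    and [measurable]: "h \<in> borel_measurable borel" and B: "\<And>x. \<bar>h x\<bar> \<le> B"
  shows "\<bar>(\<integral>y. h (\<gamma> * y) \<partial>std_normal_distribution) - (\<integral>x. h x \<partial>H_law (Phi C) \<gamma>)\<bar> \<le> B / \<gamma> ^ 4"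
proof -
  interpret N: prob_space std_normal_distribution by (rule prob_space_normal_density) simp
  have B0: "0 \<le> B" using B[of 0] by linarith
  have \<gamma>4: "1 \<le> \<gamma> ^ 4" using \<gamma> by simp
  define p where "p = N.expectation (\<lambda>y. Phi C (y / \<gamma>))"
  have int4: "integrable std_normal_distribution (\<lambda>y. y ^ 4)"
    by (rule integrable_std_normal_distribution_moment)
  have "N.expectation (\<lambda>y. 1 - C * y ^ 4 / (4 * \<gamma> ^ 4)) \<le> p"
    unfolding p_def
  proof (rule integral_mono)
    show "integrable std_normal_distribution (\<lambda>y. 1 - C * y ^ 4 / (4 * \<gamma> ^ 4))"
      using int4 by auto
    show "integrable std_normal_distribution (\<lambda>y. Phi C (y / \<gamma>))"
      using Phi_bounds[OF C(1)] by (intro N.integrable_const_bound[of _ 1]) auto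
    show "1 - C * y ^ 4 / (4 * \<gamma> ^ 4) \<le> Phi C (y / \<gamma>)" for y
      using Phi_bounds(3)[OF C(1), of "y / \<gamma>"] by (simp add: power_divide mult.commute)
  qed
  moreover have "N.expectation (\<lambda>y. y ^ 4) = 3"
    using std_normal_distribution_even_moments(1)[of 2] by (simp add: fact_numeral)
  ultimately have p_ge: "1 - 3 * C / (4 * \<gamma> ^ 4) \<le> p"
    using int4 N.prob_space by (simp add: mult.commute)
  have small: "3 * C / (4 * \<gamma> ^ 4) \<le> 1 / (4 * \<gamma> ^ 4)"
    using C \<gamma>4 by (intro divide_right_mono) auto
  also have "\<dots> \<le> 1 / (4 * 1)" using \<gamma>4 by (intro divide_left_mono) auto
  finally have p: "3 / 4 \<le> p" using p_ge by linarith
  have "\<bar>(\<integral>y. h (\<gamma> * y) \<partial>std_normal_distribution) - (\<integral>x. h x \<partial>H_law (Phi C) \<gamma>)\<bar>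
      \<le> 2 * B * (1 - p) / p"
    unfolding p_def using \<gamma> p
    by (subst integral_H_law)
      (auto simp: C p_def intro!: N.tilted_expectation_bound B Phi_bounds)
  \<comment> \<open>The denominator is at least 3/4; rounding it down to 1/2 makes the constant
    exactly 1.\<close>
  also have "\<dots> \<le> 2 * B * (1 / (4 * \<gamma> ^ 4)) / (1 / 2)"
    using p p_ge small B0 \<gamma>4 by (intro frac_le mult_left_mono mult_nonneg_nonneg) auto
  also have "\<dots> = B / \<gamma> ^ 4" by simp
  finally show ?thesis .
qed

section \<open>The test class and its distance\<close>

lemma sup_norm_upper:
  assumes "bounded (range f)"
  shows "\<bar>f x\<bar> \<le> sup_norm f"
proof -
  obtain b where "\<forall>y\<in>range f. norm y \<le> b" using assms by (auto simp: bounded_iff)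
  then have "bdd_above (range (\<lambda>x. \<bar>f x\<bar>))" by (intro bdd_aboveI[of _ b]) auto
  then show ?thesis unfolding sup_norm_def by (rule cSUP_upper[rotated]) simp
qed

lemma H1_PhiD:
  assumes "h \<in> H1_Phi"
  shows "(h has_real_derivative deriv h x) (at x)" "\<bar>deriv h x\<bar> \<le> sup_norm (deriv h)"
    "\<bar>h x\<bar> \<le> sup_norm h" "sup_norm h \<le> 1" "sup_norm (deriv h) \<le> 1"
proof -
  have "h differentiable (at x)"
    using assms by (auto simp: H1_Phi_def C1_differentiable_on_eq)
  then show "(h has_real_derivative deriv h x) (at x)"
    using DERIV_imp_deriv real_differentiable_def by metis
qed (use assms in \<open>auto simp: H1_Phi_def intro!: sup_norm_upper\<close>)

text \<open>Shows that the supremum defining the distance is over a nonempty set, so that a uniform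
  bound passes to it.\<close>

lemma zero_in_H1_Phi: "(\<lambda>_. 0) \<in> H1_Phi"
proof -
  have "bounded (range (\<lambda>_::real. 0::real))" by simp
  then show ?thesis
    by (simp add: H1_Phi_def sup_norm_def)
qed

lemma dist_H1_Phi_le:
  assumes "\<And>h. h \<in> H1_Phi \<Longrightarrow> \<bar>(\<integral>\<omega>. h (U \<omega>) \<partial>M) - (\<integral>\<omega>. h (V \<omega>) \<partial>N)\<bar> \<le> b"
  shows "dist_H1_Phi M U N V \<le> b"
  unfolding dist_H1_Phi_def using zero_in_H1_Phi assms by (intro cSUP_least) auto

theorem theorem4p1:
  fixes M :: "'a measure" and X :: "'a \<Rightarrow> real" and Xs :: "nat \<Rightarrow> 'a \<Rightarrow> real"
    and N :: "nat \<Rightarrow> 'b measure" and H :: "nat \<Rightarrow> 'b \<Rightarrow> real"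
    and Z :: "nat \<Rightarrow> 'a \<Rightarrow> real" and \<gamma> :: "nat \<Rightarrow> real" and C c1 \<sigma>13 :: real
  assumes "prob_space M"
    and "X \<in> borel_measurable M"
    and "prob_space.indep_vars M (\<lambda>_. borel) Xs {1..}"
    and "\<And>k. k \<ge> 1 \<Longrightarrow> distr M borel (Xs k) = distr M borel X"
    and "distr M borel (\<lambda>\<omega>. - X \<omega>) = distr M borel X"
    and "integrable M (\<lambda>\<omega>. X \<omega> ^ 4)"
    and "(\<integral>\<omega>. X \<omega> \<partial>M) = 0"
    and "(\<integral>\<omega>. (X \<omega>)\<^sup>2 \<partial>M) = 1"
    and "(\<integral>\<omega>. X \<omega> ^ 4 \<partial>M) < 3"
  defines "\<gamma> \<equiv> \<lambda>n. real n powr (1 / 4)"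
    and "Z \<equiv> \<lambda>n \<omega>. (\<Sum>k=1..n. Xs k \<omega>) / real n powr (1 / 4)"
    and "C \<equiv> (3 - (\<integral>\<omega>. X \<omega> ^ 4 \<partial>M)) / 6"
    and "c1 \<equiv> sqrt (2 * pi) * (\<integral>x. Phi C x \<partial>density lborel std_normal_density)"
    and "\<sigma>13 \<equiv> max (\<integral>\<omega>. \<bar>X \<omega>\<bar> \<partial>M) (\<integral>\<omega>. \<bar>X \<omega>\<bar> ^ 3 / 2 \<partial>M)"
  assumes "\<And>n. n \<ge> 1 \<Longrightarrow> prob_space (N n)"
    and "\<And>n. n \<ge> 1 \<Longrightarrow> H n \<in> borel_measurable (N n)"
    and "\<And>n. n \<ge> 1 \<Longrightarrow> distr (N n) borel (H n) = H_law (Phi C) (\<gamma> n)"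
  shows "(\<forall>n\<ge>1. \<forall>h\<in>H1_Phi.
            \<bar>(\<integral>\<omega>. h (Z n \<omega>) \<partial>M) - (\<integral>\<omega>. h (H n \<omega>) \<partial>N n)\<bar>
              \<le> 4 * sqrt (2 * (1 - C)) / \<gamma> n * sup_norm (deriv h)
                + 4 / (\<gamma> n)\<^sup>2 * sup_norm h * (C * c1 * \<sigma>13 + 1 / (\<gamma> n)\<^sup>2))
       \<and> (\<exists>r \<in> O(\<lambda>n. 1 / (\<gamma> n)\<^sup>2). \<forall>\<^sub>F n in sequentially.
            dist_H1_Phi M (Z n) (N n) (H n) \<le> 4 * sqrt (2 * (1 - C)) / \<gamma> n + r n)
       \<and> (\<exists>r \<in> O(\<lambda>n. 1 / \<gamma> n ^ 4). \<forall>\<^sub>F n in sequentially.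
            dist_H1_Phi M (\<lambda>\<omega>. Z n \<omega> / \<gamma> n) (N n) (\<lambda>\<omega>. H n \<omega> / \<gamma> n)
              \<le> 4 * sqrt (2 * (1 - C)) / (\<gamma> n)\<^sup>2 + r n)"
proof -
  interpret prob_space M by fact
  note [measurable] = assms(2)
  have Xs_meas [measurable]: "Xs k \<in> borel_measurable M" if "k \<ge> 1" for k
    using assms(3) that by (auto simp: indep_vars_def)
  \<comment> \<open>The variables are related through their laws alone, so integrability and
    expectations pass through the image measures.\<close>
  have int_transfer: "integrable M (\<lambda>\<omega>. g (Xs k \<omega>)) \<longleftrightarrow> integrable M (\<lambda>\<omega>. g (X \<omega>))"
    if "k \<ge> 1" and [measurable]: "g \<in> borel_measurable borel" for k and g :: "real \<Rightarrow> real"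
    using assms(4)[OF that(1)] integrable_distr_eq[OF Xs_meas[OF that(1)], of g]
      integrable_distr_eq[of X M borel g] by simp
  have E_transfer: "(\<integral>\<omega>. g (Xs k \<omega>) \<partial>M) = (\<integral>\<omega>. g (X \<omega>) \<partial>M)"
    if "k \<ge> 1" and [measurable]: "g \<in> borel_measurable borel" for k and g :: "real \<Rightarrow> real"
    using assms(4)[OF that(1)] integral_distr[OF Xs_meas[OF that(1)], of g]
      integral_distr[of X M borel g] by simp

  \<comment> \<open>Moment inequalities for \<open>X\<close>\<close>
  define m1 m3 m4 where "m1 = (\<integral>\<omega>. \<bar>X \<omega>\<bar> \<partial>M)" and "m3 = (\<integral>\<omega>. \<bar>X \<omega>\<bar> ^ 3 \<partial>M)"
    and "m4 = (\<integral>\<omega>. X \<omega> ^ 4 \<partial>M)"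
  have int4: "integrable M (\<lambda>\<omega>. \<bar>X \<omega>\<bar> ^ 4)" using assms(6) by simp
  have int1: "integrable M (\<lambda>\<omega>. \<bar>X \<omega>\<bar>)" using integrable_abs_power_mono[OF _ int4, of 1] by simp
  have int2: "integrable M (\<lambda>\<omega>. (X \<omega>)\<^sup>2)" using integrable_abs_power_mono[OF _ int4, of 2] by simp
  have int3: "integrable M (\<lambda>\<omega>. \<bar>X \<omega>\<bar> ^ 3)" using integrable_abs_power_mono[OF _ int4, of 3] by simp
  have m4_ge: "1 \<le> m4"
  proof -
    \<comment> \<open>The variance of the square of \<open>X\<close> is \<open>m4 - 1\<close>; its
      nonnegativity is what gives \<open>C \<le> 1 / 3\<close>.\<close>
    have "0 \<le> (\<integral>\<omega>. ((X \<omega>)\<^sup>2 - 1)\<^sup>2 \<partial>M)" by (intro Bochner_Integration.integral_nonneg) auto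
    also have "\<dots> = (\<integral>\<omega>. X \<omega> ^ 4 - 2 * (X \<omega>)\<^sup>2 + 1 \<partial>M)"
      by (intro Bochner_Integration.integral_cong) (auto simp: power2_eq_square power4_eq_xxxx algebra_simps)
    also have "\<dots> = m4 - 1"
      using assms(6) int2 assms(8) by (simp add: m4_def prob_space)
    finally show ?thesis by simp
  qed
  have C_eq: "C = (3 - m4) / 6" by (simp add: C_def m4_def)
  have C: "0 < C" "C \<le> 1 / 3" using assms(9) m4_ge by (auto simp: C_eq m4_def)
  have m1_le: "m1 \<le> 1"
  proof -
    have "\<bar>x\<bar> \<le> (1 + x\<^sup>2) / 2" for x :: real
      using zero_le_power2[of "\<bar>x\<bar> - 1"] by (simp add: power2_diff)
    then have "m1 \<le> (\<integral>\<omega>. (1 + (X \<omega>)\<^sup>2) / 2 \<partial>M)"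
      unfolding m1_def using int1 int2 by (intro integral_mono) auto
    then show ?thesis using int2 assms(8) by (simp add: prob_space)
  qed
  have m3_le: "m3 \<le> (1 + m4) / 2"
  proof -
    have "\<bar>x\<bar> ^ 3 \<le> (x\<^sup>2 + x ^ 4) / 2" for x :: real
    proof -
      have "0 \<le> x\<^sup>2 * (\<bar>x\<bar> - 1)\<^sup>2" by simp
      also have "\<dots> = \<bar>x\<bar>\<^sup>2 * (\<bar>x\<bar> - 1)\<^sup>2" by simp
      also have "\<dots> = \<bar>x\<bar>\<^sup>2 + \<bar>x\<bar> ^ 4 - 2 * \<bar>x\<bar> ^ 3"
        by (simp only: power2_eq_square power3_eq_cube power4_eq_xxxx) (simp only: algebra_simps)
      finally show ?thesis by simp
    qed
    then have "m3 \<le> (\<integral>\<omega>. ((X \<omega>)\<^sup>2 + X \<omega> ^ 4) / 2 \<partial>M)"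
      unfolding m3_def using int3 int2 assms(6) by (intro integral_mono) auto
    then show ?thesis using int2 assms(6,8) by (simp add: m4_def)
  qed
  \<comment> \<open>The bounds on \<open>m1\<close> and \<open>m3\<close> give at most
    \<open>(1 + m4) / 2 + 2\<close>, which is \<open>4 - 3 * C\<close> because
    \<open>m4 = 3 - 6 * C\<close>. After squaring, the comparison with the root reads
    \<open>9 * C\<^sup>2 + 8 * C \<le> 16\<close>, true for \<open>C \<le> 1 / 3\<close>.\<close>
  have moments: "m3 + 2 * m1 \<le> 4 * sqrt (2 * (1 - C))"
  proof -
    have "C * C \<le> 1 / 3 * (1 / 3)" using C by (intro mult_mono) auto
    then have "(4 - 3 * C)\<^sup>2 \<le> 4\<^sup>2 * (2 * (1 - C))"
      using C by (simp add: power2_eq_square algebra_simps)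
    then have "4 - 3 * C \<le> sqrt (4\<^sup>2 * (2 * (1 - C)))" by (rule real_le_rsqrt)
    also have "\<dots> = 4 * sqrt (2 * (1 - C))" by (simp only: real_sqrt_mult) simp
    finally show ?thesis using m1_le m3_le by (simp add: C_eq field_simps)
  qed

  \<comment> \<open>Scaling and comparison of \<open>Z n\<close> with \<open>H n\<close>\<close>
  have \<gamma>1: "1 \<le> \<gamma> n" if "n \<ge> 1" for n
    using that by (simp add: \<gamma>_def ge_one_powr_ge_zero)
  have \<gamma>2: "(\<gamma> n)\<^sup>2 = sqrt n" and \<gamma>4: "\<gamma> n ^ 4 = n" if "n \<ge> 1" for n
    using that by (auto simp: \<gamma>_def powr_power powr_half_sqrt)

  \<comment> \<open>Stated for any differentiable \<open>h\<close> with bounds \<open>L\<close> and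
    \<open>B\<close>, so that it also applies to the rescaled function
    \<open>h (x / \<gamma> n)\<close>, with a smaller \<open>L\<close>.\<close>
  have core: "\<bar>(\<integral>\<omega>. h (Z n \<omega>) \<partial>M) - (\<integral>\<omega>. h (H n \<omega>) \<partial>N n)\<bar>
      \<le> 4 * sqrt (2 * (1 - C)) / \<gamma> n * L + B / \<gamma> n ^ 4"
    if n: "n \<ge> 1" and h: "\<And>x. (h has_real_derivative h' x) (at x)"
      and L: "\<And>x. \<bar>h' x\<bar> \<le> L" and B: "\<And>x. \<bar>h x\<bar> \<le> B" for n h h' L B
  proof -
    have L0: "0 \<le> L" using L[of 0] by linarith
    have [measurable]: "h \<in> borel_measurable borel"
      by (rule borel_measurable_continuous_onI, rule DERIV_continuous_on, rule h)
    have \<gamma>pos: "0 < \<gamma> n" using \<gamma>1[OF n] by linarith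
    define s where "s = sqrt n"
    have s: "s > 0" "s\<^sup>2 = real n" "(\<gamma> n)\<^sup>2 = s" using n \<gamma>2[OF n] by (auto simp: s_def)
    define \<xi> where "\<xi> k \<omega> = Xs k \<omega> / s" for k \<omega>
    have indep: "indep_vars (\<lambda>_. borel) \<xi> {1..n}"
    proof -
      have "indep_vars (\<lambda>_. borel) Xs {1..n}" by (rule indep_vars_subset[OF assms(3)]) auto
      then have "indep_vars (\<lambda>_. borel) (\<lambda>k \<omega>. Xs k \<omega> / s) {1..n}"
        by (rule indep_vars_compose2[where Y = "\<lambda>_ x. x / s"]) auto
      then show ?thesis by (simp add: \<xi>_def[abs_def])
    qed
    have \<xi>3: "integrable M (\<lambda>\<omega>. \<bar>\<xi> k \<omega>\<bar> ^ 3)" "(\<integral>\<omega>. \<bar>\<xi> k \<omega>\<bar> ^ 3 \<partial>M) = m3 / s ^ 3"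
      and \<xi>2: "(\<integral>\<omega>. (\<xi> k \<omega>)\<^sup>2 \<partial>M) = 1 / n"
      and \<xi>1: "(\<integral>\<omega>. \<bar>\<xi> k \<omega>\<bar> \<partial>M) = m1 / s" "(\<integral>\<omega>. \<xi> k \<omega> \<partial>M) = 0" if "k \<in> {1..n}" for k
    proof -
      have k: "k \<ge> 1" using that by simp
      show "integrable M (\<lambda>\<omega>. \<bar>\<xi> k \<omega>\<bar> ^ 3)"
        using int_transfer[OF k, of "\<lambda>x. \<bar>x\<bar> ^ 3"] int3 by (simp add: \<xi>_def abs_divide power_divide)
      show "(\<integral>\<omega>. \<bar>\<xi> k \<omega>\<bar> ^ 3 \<partial>M) = m3 / s ^ 3"
        using E_transfer[OF k, of "\<lambda>x. \<bar>x\<bar> ^ 3"] s by (simp add: \<xi>_def abs_divide power_divide m3_def)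
      show "(\<integral>\<omega>. (\<xi> k \<omega>)\<^sup>2 \<partial>M) = 1 / n"
        using E_transfer[OF k, of "\<lambda>x. x\<^sup>2"] s assms(8) by (simp add: \<xi>_def power_divide)
      show "(\<integral>\<omega>. \<bar>\<xi> k \<omega>\<bar> \<partial>M) = m1 / s"
        using E_transfer[OF k, of "\<lambda>x. \<bar>x\<bar>"] s by (simp add: \<xi>_def abs_divide m1_def)
      show "(\<integral>\<omega>. \<xi> k \<omega> \<partial>M) = 0"
        using E_transfer[OF k, of "\<lambda>x. x"] assms(7) by (simp add: \<xi>_def)
    qed
    have dscale: "((\<lambda>x. h (\<gamma> n * x)) has_real_derivative \<gamma> n * h' (\<gamma> n * x)) (at x)" for x
      by (rule DERIV_cong[OF DERIV_chain2[OF h]]) (auto intro!: derivative_eq_intros)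
    have Z: "Z n \<omega> = \<gamma> n * (\<Sum>k\<in>{1..n}. \<xi> k \<omega>)" for \<omega>
    proof -
      have "Z n \<omega> = (\<Sum>k=1..n. Xs k \<omega>) / \<gamma> n" by (simp add: Z_def \<gamma>_def)
      then show ?thesis
        using \<gamma>pos unfolding \<xi>_def s(3)[symmetric] sum_divide_distrib[symmetric]
        by (simp add: power2_eq_square)
    qed
    \<comment> \<open>Normal approximation is applied to \<open>h (\<gamma> n * x)\<close>, whose
      Lipschitz constant is \<open>\<gamma> n * L\<close>.\<close>
    have "\<bar>(\<integral>\<omega>. h (Z n \<omega>) \<partial>M) - (\<integral>x. h (\<gamma> n * x) \<partial>std_normal_distribution)\<bar>
        \<le> \<gamma> n * L * (\<Sum>k\<in>{1..n}. (\<integral>\<omega>. \<bar>\<xi> k \<omega>\<bar> ^ 3 \<partial>M)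
            + 2 * (\<integral>\<omega>. (\<xi> k \<omega>)\<^sup>2 \<partial>M) * (\<integral>\<omega>. \<bar>\<xi> k \<omega>\<bar> \<partial>M))"
      unfolding Z
      by (rule normal_approximation_sum[OF _ indep \<xi>3(1) \<xi>1(2) _ dscale])
        (use \<gamma>pos n L B \<xi>2 in \<open>auto simp: abs_mult\<close>)
    also have "(\<Sum>k\<in>{1..n}. (\<integral>\<omega>. \<bar>\<xi> k \<omega>\<bar> ^ 3 \<partial>M) + 2 * (\<integral>\<omega>. (\<xi> k \<omega>)\<^sup>2 \<partial>M) * (\<integral>\<omega>. \<bar>\<xi> k \<omega>\<bar> \<partial>M))
        = real n * (m3 / s ^ 3 + 2 * (1 / n) * (m1 / s))"
      using \<xi>3(2) \<xi>2 \<xi>1(1) by simp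
    also have "\<dots> = (m3 + 2 * m1) / s"
      using s(1) unfolding s(2)[symmetric] by (simp add: field_simps power2_eq_square power3_eq_cube)
    \<comment> \<open>The rate is \<open>\<gamma> n / s = 1 / \<gamma> n\<close>, since
      \<open>s\<close> is the square of \<open>\<gamma> n\<close>.\<close>
    also have "\<gamma> n * L * ((m3 + 2 * m1) / s) = (m3 + 2 * m1) / \<gamma> n * L"
      using \<gamma>pos unfolding s(3)[symmetric] by (simp add: power2_eq_square)
    also have "\<dots> \<le> 4 * sqrt (2 * (1 - C)) / \<gamma> n * L"
      using \<gamma>pos L0 moments by (intro mult_right_mono divide_right_mono) auto
    finally have part1: "\<bar>(\<integral>\<omega>. h (Z n \<omega>) \<partial>M) - (\<integral>x. h (\<gamma> n * x) \<partial>std_normal_distribution)\<bar>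
        \<le> 4 * sqrt (2 * (1 - C)) / \<gamma> n * L" .
    have "(\<integral>\<omega>. h (H n \<omega>) \<partial>N n) = (\<integral>x. h x \<partial>H_law (Phi C) (\<gamma> n))"
      using assms(16,17)[OF n] integral_distr[of "H n" "N n" borel h] by simp
    then have "\<bar>(\<integral>x. h (\<gamma> n * x) \<partial>std_normal_distribution) - (\<integral>\<omega>. h (H n \<omega>) \<partial>N n)\<bar> \<le> B / \<gamma> n ^ 4"
      using normal_vs_H_law[OF \<gamma>1[OF n] less_imp_le[OF C(1)] C(2) \<open>h \<in> borel_measurable borel\<close> B] by simp
    with part1 show ?thesis by linarith
  qed

  have c1: "0 \<le> c1" and \<sigma>: "0 \<le> \<sigma>13"
    unfolding c1_def \<sigma>13_def
    by (auto intro!: Bochner_Integration.integral_nonneg mult_nonneg_nonneg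
        simp: Phi_def le_max_iff_disj)
  then have D: "0 \<le> C * c1 * \<sigma>13" using C by simp

  have bound: "\<bar>(\<integral>\<omega>. h (Z n \<omega>) \<partial>M) - (\<integral>\<omega>. h (H n \<omega>) \<partial>N n)\<bar>
      \<le> 4 * sqrt (2 * (1 - C)) / \<gamma> n * sup_norm (deriv h)
        + 4 / (\<gamma> n)\<^sup>2 * sup_norm h * (C * c1 * \<sigma>13 + 1 / (\<gamma> n)\<^sup>2)"
    if n: "n \<ge> 1" and h: "h \<in> H1_Phi" for n h
  proof -
    have "0 \<le> sup_norm h" using H1_PhiD(3)[OF h, of 0] by linarith
    \<comment> \<open>The error \<open>sup_norm h / \<gamma> n ^ 4\<close> fits under the second
      term of the claim because \<open>C * c1 * \<sigma>13\<close> is nonnegative.\<close>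
    then have "1 / (\<gamma> n)\<^sup>2 * sup_norm h * (1 / (\<gamma> n)\<^sup>2)
        \<le> 4 / (\<gamma> n)\<^sup>2 * sup_norm h * (C * c1 * \<sigma>13 + 1 / (\<gamma> n)\<^sup>2)"
      using D by (intro mult_mono divide_right_mono) auto
    moreover have "1 / (\<gamma> n)\<^sup>2 * sup_norm h * (1 / (\<gamma> n)\<^sup>2) = sup_norm h / \<gamma> n ^ 4"
      by (simp add: power2_eq_square power4_eq_xxxx)
    ultimately show ?thesis
      using core[OF n H1_PhiD(1-3)[OF h]] by linarith
  qed

  \<comment> \<open>Bounds for the two distances and their remainders\<close>
  have d1: "dist_H1_Phi M (Z n) (N n) (H n)
      \<le> 4 * sqrt (2 * (1 - C)) / \<gamma> n + 4 / (\<gamma> n)\<^sup>2 * (C * c1 * \<sigma>13 + 1 / (\<gamma> n)\<^sup>2)"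
    if n: "n \<ge> 1" for n
  proof (rule dist_H1_Phi_le)
    fix h assume h: "h \<in> H1_Phi"
    have "4 * sqrt (2 * (1 - C)) / \<gamma> n * sup_norm (deriv h) \<le> 4 * sqrt (2 * (1 - C)) / \<gamma> n * 1"
      using C \<gamma>1[OF n] H1_PhiD(5)[OF h] by (intro mult_left_mono) auto
    moreover have "4 / (\<gamma> n)\<^sup>2 * sup_norm h * (C * c1 * \<sigma>13 + 1 / (\<gamma> n)\<^sup>2)
        \<le> 4 / (\<gamma> n)\<^sup>2 * 1 * (C * c1 * \<sigma>13 + 1 / (\<gamma> n)\<^sup>2)"
      using D H1_PhiD(4)[OF h] by (intro mult_right_mono mult_left_mono) auto
    ultimately show "\<bar>(\<integral>\<omega>. h (Z n \<omega>) \<partial>M) - (\<integral>\<omega>. h (H n \<omega>) \<partial>N n)\<bar>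
        \<le> 4 * sqrt (2 * (1 - C)) / \<gamma> n + 4 / (\<gamma> n)\<^sup>2 * (C * c1 * \<sigma>13 + 1 / (\<gamma> n)\<^sup>2)"
      using bound[OF n h] by simp
  qed

  have d2: "dist_H1_Phi M (\<lambda>\<omega>. Z n \<omega> / \<gamma> n) (N n) (\<lambda>\<omega>. H n \<omega> / \<gamma> n)
      \<le> 4 * sqrt (2 * (1 - C)) / (\<gamma> n)\<^sup>2 + 1 / \<gamma> n ^ 4"
    if n: "n \<ge> 1" for n
  proof (rule dist_H1_Phi_le)
    fix h assume h: "h \<in> H1_Phi"
    have \<gamma>pos: "0 < \<gamma> n" using \<gamma>1[OF n] by linarith
    \<comment> \<open>Here \<open>core\<close> is used directly with
      \<open>L = 1 / \<gamma> n\<close> and \<open>B = 1\<close>: the leading term gains a factor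
      \<open>1 / \<gamma> n\<close>, and the remainder is of order
      \<open>1 / \<gamma> n ^ 4\<close>, while the second term of \<open>bound\<close> would give
      only \<open>1 / (\<gamma> n)\<^sup>2\<close>.\<close>
    have "((\<lambda>x. h (x / \<gamma> n)) has_real_derivative deriv h (x / \<gamma> n) / \<gamma> n) (at x)" for x
      by (rule DERIV_cong[OF DERIV_chain2[OF H1_PhiD(1)[OF h] DERIV_cdivide[OF DERIV_ident]]]) simp
    moreover have "\<bar>deriv h (x / \<gamma> n) / \<gamma> n\<bar> \<le> 1 / \<gamma> n" for x
      using H1_PhiD(2)[OF h, of "x / \<gamma> n"] H1_PhiD(5)[OF h] \<gamma>pos
      by (simp add: abs_divide divide_right_mono)
    moreover have "\<bar>h (x / \<gamma> n)\<bar> \<le> 1" for x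
      using H1_PhiD(3)[OF h, of "x / \<gamma> n"] H1_PhiD(4)[OF h] by linarith
    ultimately have "\<bar>(\<integral>\<omega>. h (Z n \<omega> / \<gamma> n) \<partial>M) - (\<integral>\<omega>. h (H n \<omega> / \<gamma> n) \<partial>N n)\<bar>
        \<le> 4 * sqrt (2 * (1 - C)) / \<gamma> n * (1 / \<gamma> n) + 1 / \<gamma> n ^ 4"
      by (rule core[OF n])
    then show "\<bar>(\<integral>\<omega>. h (Z n \<omega> / \<gamma> n) \<partial>M) - (\<integral>\<omega>. h (H n \<omega> / \<gamma> n) \<partial>N n)\<bar>
        \<le> 4 * sqrt (2 * (1 - C)) / (\<gamma> n)\<^sup>2 + 1 / \<gamma> n ^ 4"
      by (simp add: power2_eq_square)
  qed

  have r1: "(\<lambda>n. 4 / (\<gamma> n)\<^sup>2 * (C * c1 * \<sigma>13 + 1 / (\<gamma> n)\<^sup>2)) \<in> O(\<lambda>n. 1 / (\<gamma> n)\<^sup>2)"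
  proof (rule bigoI)
    show "\<forall>\<^sub>F n in sequentially. norm (4 / (\<gamma> n)\<^sup>2 * (C * c1 * \<sigma>13 + 1 / (\<gamma> n)\<^sup>2))
        \<le> 4 * (C * c1 * \<sigma>13 + 1) * norm (1 / (\<gamma> n)\<^sup>2)"
      using eventually_ge_at_top[of 1]
    proof eventually_elim
      case (elim n)
      have "1 / (\<gamma> n)\<^sup>2 \<le> 1" using one_le_power[OF \<gamma>1[OF elim], of 2] by (simp add: divide_le_eq_1)
      then have "4 / (\<gamma> n)\<^sup>2 * (C * c1 * \<sigma>13 + 1 / (\<gamma> n)\<^sup>2) \<le> 4 / (\<gamma> n)\<^sup>2 * (C * c1 * \<sigma>13 + 1)"
        by (intro mult_left_mono) auto
      then show ?case using D by (simp add: mult_ac)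
    qed
  qed
  have r2: "(\<lambda>n. 1 / \<gamma> n ^ 4) \<in> O(\<lambda>n. 1 / \<gamma> n ^ 4)"
    by simp

  show ?thesis
  proof (intro conjI bexI)
    \<comment> \<open>The witnesses for \<open>r\<close> are the second summands of
      \<open>d1\<close> and \<open>d2\<close>, fixed by unification with these two claims.\<close>
    show "\<forall>\<^sub>F n in sequentially. dist_H1_Phi M (Z n) (N n) (H n)
        \<le> 4 * sqrt (2 * (1 - C)) / \<gamma> n + 4 / (\<gamma> n)\<^sup>2 * (C * c1 * \<sigma>13 + 1 / (\<gamma> n)\<^sup>2)"
      using eventually_ge_at_top[of 1] by eventually_elim (rule d1)
    show "\<forall>\<^sub>F n in sequentially. dist_H1_Phi M (\<lambda>\<omega>. Z n \<omega> / \<gamma> n) (N n) (\<lambda>\<omega>. H n \<omega> / \<gamma> n)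
        \<le> 4 * sqrt (2 * (1 - C)) / (\<gamma> n)\<^sup>2 + 1 / \<gamma> n ^ 4"
      using eventually_ge_at_top[of 1] by eventually_elim (rule d2)
  qed (use bound r1 r2 in auto)
qed

end
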